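(* Let $\Delta \in \mathbb{N} \setminus \{1\}$ and let $G$ be a connected $\Delta$-regular graph (finite or infinite). Then $D'(G) \leq 3$.
   Context: Graphs are simple and undirected, and may be finite or infinite. A graph is $\Delta$-regular if every vertex has degree $\Delta$. $\operatorname{Aut}(G)$ denotes the group of automorphisms of $G$. An edge-colouring of $G$ (any map from the edge set to a set of colours, not necessarily proper) is distinguishing if the only automorphism of $G$ that preserves the colouring is the identity. The distinguishing index $D'(G)$ is the least number of colours in a distinguishing edge-colouring of $G$. *)

theory Defs
  imports "HOL-Library.Extended_Nat" "HOL-Library.FuncSet" "HOL-Combinatorics.Permutations"
begin

definition simple_graph :: "'a set \<Rightarrow> 'a set set \<Rightarrow> bool" where
  "simple_graph V E \<longleftrightarrow> (\<forall>e\<in>E. e \<subseteq> V \<and> card e = 2)"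

definition incident_edges :: "'a set set \<Rightarrow> 'a \<Rightarrow> 'a set set" where
  "incident_edges E v = {e \<in> E. v \<in> e}"

text \<open>Finiteness is explicit because \<open>card\<close> of an infinite set is 0, so otherwise vertices of
  infinite degree would count as having degree 0.\<close>
definition regular_graph :: "'a set \<Rightarrow> 'a set set \<Rightarrow> nat \<Rightarrow> bool" where
  "regular_graph V E d \<longleftrightarrow> (\<forall>v\<in>V. finite (incident_edges E v) \<and> card (incident_edges E v) = d)"

definition connected_graph :: "'a set \<Rightarrow> 'a set set \<Rightarrow> bool" where
  "connected_graph V E \<longleftrightarrow> V \<noteq> {} \<and> (\<forall>u\<in>V. \<forall>v\<in>V. (u, v) \<in> {(x, y). {x, y} \<in> E}\<^sup>*)"

text \<open>Automorphisms are permutations of \<open>V\<close> extended by the identity outside \<open>V\<close>, so each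
  automorphism is represented by exactly one function and the identity automorphism is \<open>id\<close>.\<close>
definition automorphisms :: "'a set \<Rightarrow> 'a set set \<Rightarrow> ('a \<Rightarrow> 'a) set" where
  "automorphisms V E =
     {f. f permutes V \<and> (\<forall>u\<in>V. \<forall>v\<in>V. {f u, f v} \<in> E \<longleftrightarrow> {u, v} \<in> E)}"

definition preserves_edge_colouring :: "'a set set \<Rightarrow> ('a set \<Rightarrow> 'c) \<Rightarrow> ('a \<Rightarrow> 'a) \<Rightarrow> bool" where
  "preserves_edge_colouring E c f \<longleftrightarrow> (\<forall>e\<in>E. c (f ` e) = c e)"

definition distinguishing_edge_colouring ::
    "'a set \<Rightarrow> 'a set set \<Rightarrow> ('a set \<Rightarrow> 'c) \<Rightarrow> bool" where
  "distinguishing_edge_colouring V E c \<longleftrightarrow>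
     (\<forall>f\<in>automorphisms V E. preserves_edge_colouring E c f \<longrightarrow> f = id)"

text \<open>The value is \<open>\<infinity>\<close> if no distinguishing edge-colouring with finitely many colours exists; this
  covers both an infinite index and the case, such as a single edge, where there is no
  distinguishing edge-colouring at all.\<close>
definition distinguishing_index :: "'a set \<Rightarrow> 'a set set \<Rightarrow> enat" where
  "distinguishing_index V E =
     Inf {enat k | k. \<exists>c \<in> E \<rightarrow> {..<k}. distinguishing_edge_colouring V E c}"

end

theory Submission
  imports Defs
begin

text \<open>
  Fix a root \<open>r\<close> and colour the edges red, blue and green step by step, while a set \<open>S\<close> of
  \<^emph>\<open>settled\<close> vertices grows around \<open>r\<close>. The invariant is that every automorphism which fixes \<open>r\<close> and
  preserves the final colouring fixes \<open>S\<close> pointwise. Given this, a vertex \<open>x\<close> outside \<open>S\<close> can only be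
  moved to a \<^emph>\<open>twin\<close>: a vertex outside \<open>S\<close> with the same neighbours in \<open>S\<close>, joined to them by edges of
  the same colours. To settle a whole class \<open>C\<close> of twins, separate its members by their numbers of red
  edges.

  Let \<open>C\<close> have members \<open>u\<^sub>0, \<dots>, u\<^sub>k\<^sub>-\<^sub>1\<close>, each with \<open>d\<close> neighbours in \<open>S\<close>. The member \<open>u\<^sub>i\<close> is promised
  exactly \<open>i\<close> red edges besides those to \<open>S\<close>, and an edge \<open>u\<^sub>iu\<^sub>j\<close> inside \<open>C\<close> is made red iff
  \<open>i + j \<ge> k\<close>. Whatever the edges inside \<open>C\<close> are, \<open>u\<^sub>i\<close> gets at most \<open>i\<close> red and at most \<open>k - i\<close> blue
  ones among them. If \<open>2k + d \<le> \<Delta> + 2\<close>, the number of red edges still owed to \<open>u\<^sub>i\<close> is therefore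
  nonnegative and at most half, rounded up, of its edges that leave \<open>S \<union> C\<close> (lemma \<open>settle_twins\<close>).

  Later a settled vertex \<open>s\<close> is \<^emph>\<open>exposed\<close>: all its edges that leave \<open>S\<close> are coloured, and as many of
  them are red as it was promised. As these are at most about half of the edges, the colours can at the
  same time cut every class of twins among the outer neighbours of \<open>s\<close> into parts of at most half its
  size, rounded up (lemmas \<open>balanced_split\<close> and \<open>expose\<close>). This keeps \<open>2k + d \<le> \<Delta> + 2\<close> true: the classes
  cut by \<open>r\<close> have at most \<open>\<lceil>\<Delta>/2\<rceil>\<close> members; a settled vertex other than \<open>r\<close> has a settled neighbour,
  hence at most \<open>\<Delta> - 1\<close> outer ones, and the classes that it cuts first have at most \<open>\<Delta>/2\<close> members; and
  each further exposure raises \<open>d\<close> by one, but removes at least one member from a class of two or more.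
  For \<open>k = 1\<close> the inequality only says \<open>d \<le> \<Delta>\<close>.

  Finally the root must be recognisable. It has no blue edge and \<open>\<lceil>\<Delta>/2\<rceil>\<close> green ones. Any other vertex
  that is settled while it has an unsettled neighbour gets a blue edge. A vertex \<open>x\<close> whose neighbours are
  all settled before it has fewer green edges than the root: an exposure
  makes at most half, rounded down, of a class green, so \<open>k * 2 ^ g \<le> \<Delta> - 1\<close> for a class of \<open>k\<close> vertices
  with \<open>g\<close> green edges each, and hence \<open>2 ^ g \<le> \<Delta> - 1\<close> for \<open>x\<close>. The bound on classes fails at the
  green neighbours of the root, so these are settled before anything else happens.

  A step is possible until all vertices are settled and exposed. Since the graph is locally finite, the
  invariants pass to unions of chains of partial colourings, so Zorn's lemma provides a partial
  colouring to which no step applies.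
\<close>

abbreviation (input) red :: nat where "red \<equiv> 0"
abbreviation (input) blue :: nat where "blue \<equiv> 1"
abbreviation (input) green :: nat where "green \<equiv> 2"

section \<open>Halving classes with a prescribed number of red elements\<close>

lemma card_filter_eq_sum: "finite Y \<Longrightarrow> card {y \<in> Y. P y} = (\<Sum>y\<in>Y. of_bool (P y))"
  by (simp add: sum.If_cases Int_def of_bool_def)

text \<open>As long as some class of \<open>g\<close> has two elements left, pair them up: one becomes blue, the other one
  red while red elements are still owed and green otherwise. Each colour then takes at most half of each
  class, up to the last unpaired element, and that element is red or blue, so green never exceeds half.
  The last conclusion provides the blue edges that tell other vertices from the root.\<close>
lemma balanced_split:
  fixes g :: "'a \<Rightarrow> 'b" and q :: nat
  assumes "finite Y" and "2 * q \<le> card Y + 1"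
  obtains h :: "'a \<Rightarrow> nat" where
    "\<And>y. h y < 3" and "card {y \<in> Y. h y = red} = q"
    and "\<And>k j. 2 * card {y \<in> Y. g y = k \<and> h y = j} \<le> card {y \<in> Y. g y = k} + 1"
    and "\<And>k. 2 * card {y \<in> Y. g y = k \<and> h y = green} \<le> card {y \<in> Y. g y = k}"
    and "q < card Y \<Longrightarrow> \<exists>y\<in>Y. h y = blue"
proof -
  have "\<exists>h :: 'a \<Rightarrow> nat. (\<forall>y. h y < 3) \<and> card {y \<in> Y. h y = red} = q
      \<and> (\<forall>k j. 2 * card {y \<in> Y. g y = k \<and> h y = j} \<le> card {y \<in> Y. g y = k} + 1)
      \<and> (\<forall>k. 2 * card {y \<in> Y. g y = k \<and> h y = green} \<le> card {y \<in> Y. g y = k})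
      \<and> (q < card Y \<longrightarrow> (\<exists>y\<in>Y. h y = blue))"
    using assms
  proof (induction "card Y" arbitrary: Y q rule: less_induct)
    case less
    show ?case
    proof (cases "inj_on g Y")
      case True
      have "q \<le> card Y" using less.prems by linarith
      then obtain Q where Q: "Q \<subseteq> Y" "card Q = q"
        by (meson obtain_subset_with_card_n)
      define h :: "'a \<Rightarrow> nat" where "h = (\<lambda>y. if y \<in> Q then red else blue)"
      have sub: "card {y \<in> Y. g y = k} \<le> 1" for k
        using True less.prems(1) by (auto simp: card_le_Suc0_iff_eq inj_on_def)
      have "{y \<in> Y. h y = red} = Q" using Q by (auto simp: h_def)
      moreover have "2 * card {y \<in> Y. g y = k \<and> h y = j} \<le> card {y \<in> Y. g y = k} + 1" for k j
      proof -
        have "card {y \<in> Y. g y = k \<and> h y = j} \<le> card {y \<in> Y. g y = k}"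
          by (rule card_mono) (use less.prems in auto)
        then show ?thesis using sub[of k] by linarith
      qed
      moreover have "{y \<in> Y. g y = k \<and> h y = green} = {}" for k by (auto simp: h_def)
      moreover have "\<exists>y\<in>Y. h y = blue" if "q < card Y"
      proof -
        have "Q \<noteq> Y" using that Q by auto
        then show ?thesis using Q by (auto simp: h_def)
      qed
      ultimately show ?thesis using Q by (intro exI[of _ h]) (auto simp: h_def)
    next
      case False
      then obtain y z where yz: "y \<in> Y" "z \<in> Y" "y \<noteq> z" "g y = g z"
        by (auto simp: inj_on_def)
      define Y0 where "Y0 = Y - {y, z}"
      have Y: "Y = insert y (insert z Y0)" and nin: "y \<notin> Y0" "z \<notin> Y0" and fin: "finite Y0"
        using yz less.prems by (auto simp: Y0_def)
      have cY: "card Y = Suc (Suc (card Y0))" using Y nin fin yz by simp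
      \<comment> \<open>truncated subtraction is intended: for \<open>q = 0\<close> the pair contributes no red element\<close>
      have "card Y0 < card Y" "2 * (q - 1) \<le> card Y0 + 1"
        using cY less.prems(2) by auto
      from less.hyps[OF this(1) fin this(2)] obtain h :: "'a \<Rightarrow> nat" where
        h: "\<forall>y. h y < 3" "card {y \<in> Y0. h y = red} = q - 1"
          "\<forall>k j. 2 * card {y \<in> Y0. g y = k \<and> h y = j} \<le> card {y \<in> Y0. g y = k} + 1"
          "\<forall>k. 2 * card {y \<in> Y0. g y = k \<and> h y = green} \<le> card {y \<in> Y0. g y = k}"
        by blast
      define a :: nat where "a = (if q = 0 then green else red)"
      define h' where "h' = h(y := a, z := blue)"
      have split: "card {w \<in> Y. P (h' w) w} = of_bool (P a y) + of_bool (P blue z) + card {w \<in> Y0. P (h w) w}"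
        for P :: "nat \<Rightarrow> 'a \<Rightarrow> bool"
      proof -
        have "card {w \<in> Y. P (h' w) w} = (\<Sum>w\<in>Y. of_bool (P (h' w) w))"
          by (rule card_filter_eq_sum[OF less.prems(1)])
        also have "\<dots> = of_bool (P a y) + (of_bool (P blue z) + (\<Sum>w\<in>Y0. of_bool (P (h' w) w)))"
          unfolding Y using fin nin yz by (subst sum.insert, simp, simp, subst sum.insert)
              (auto simp: h'_def)
        also have "(\<Sum>w\<in>Y0. of_bool (P (h' w) w)) = (\<Sum>w\<in>Y0. of_bool (P (h w) w) :: nat)"
          by (rule sum.cong) (use nin in \<open>auto simp: h'_def\<close>)
        finally show ?thesis using fin by (simp add: card_filter_eq_sum)
      qed
      have "card {w \<in> Y. h' w = red} = q"
        using split[of "\<lambda>b w. b = red"] h(2) by (auto simp: a_def)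
      moreover have "2 * card {w \<in> Y. g w = k \<and> h' w = j} \<le> card {w \<in> Y. g w = k} + 1" for k j
        using split[of "\<lambda>b w. g w = k \<and> b = j"] split[of "\<lambda>b w. g w = k"] h(3)[rule_format, of k j] yz
        by (auto simp: a_def split: if_splits)
      moreover have "2 * card {w \<in> Y. g w = k \<and> h' w = green} \<le> card {w \<in> Y. g w = k}" for k
        using split[of "\<lambda>b w. g w = k \<and> b = green"] split[of "\<lambda>b w. g w = k"] h(4)[rule_format, of k] yz
        by (auto simp: a_def split: if_splits)
      moreover have "\<forall>w. h' w < 3" using h(1) by (auto simp: h'_def a_def)
      moreover have "\<exists>w\<in>Y. h' w = blue" using yz by (auto simp: h'_def)
      ultimately show ?thesis by blast
    qed
  qed
  then show ?thesis using that by blast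
qed

section \<open>Neighbourhoods, traces and twins\<close>

locale rooted_regular =
  fixes V :: "'a set" and E :: "'a set set" and \<Delta> :: nat and r :: 'a
  assumes simple: "simple_graph V E" and connected: "connected_graph V E"
    and regular: "regular_graph V E \<Delta>" and degree_ge_2: "2 \<le> \<Delta>" and root_in: "r \<in> V"
begin

definition nbrs :: "'a \<Rightarrow> 'a set" where "nbrs v = {u. {v, u} \<in> E}"

lemma nbrs_sym: "u \<in> nbrs v \<longleftrightarrow> v \<in> nbrs u" by (simp add: nbrs_def insert_commute)

lemma edgeE:
  assumes "e \<in> E" obtains u v where "e = {u, v}" "u \<noteq> v" "u \<in> V" "v \<in> V" "v \<in> nbrs u"
  using assms simple by (auto simp: simple_graph_def card_2_iff nbrs_def)

lemma nbrs_irrefl: "v \<notin> nbrs v"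
  using simple by (auto simp: simple_graph_def nbrs_def)

lemma nbrs_in_V: "u \<in> nbrs v \<Longrightarrow> u \<in> V" "u \<in> nbrs v \<Longrightarrow> v \<in> V"
  using simple by (auto simp: simple_graph_def nbrs_def)

lemma nbrs_subset: "nbrs v \<subseteq> V" using nbrs_in_V by auto

lemma nbrs_bij: "bij_betw (\<lambda>u. {v, u}) (nbrs v) (incident_edges E v)"
proof (rule bij_betwI')
  fix x y assume "x \<in> nbrs v" "y \<in> nbrs v"
  then show "({v, x} = {v, y}) = (x = y)" by (auto simp: doubleton_eq_iff)
next
  fix x assume "x \<in> nbrs v" then show "{v, x} \<in> incident_edges E v"
    by (auto simp: incident_edges_def nbrs_def)
next
  fix e assume "e \<in> incident_edges E v"
  then have "e \<in> E" "v \<in> e" by (auto simp: incident_edges_def)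
  then show "\<exists>x\<in>nbrs v. e = {v, x}"
    by (elim edgeE) (auto simp: nbrs_def insert_commute)
qed

lemma finite_nbrs: "finite (nbrs v)"
proof (cases "v \<in> V")
  case True then show ?thesis
    using regular bij_betw_finite[OF nbrs_bij[of v]] by (auto simp: regular_graph_def)
next
  case False then have "nbrs v = {}" using nbrs_in_V by auto
  then show ?thesis by simp
qed

lemma card_nbrs: "v \<in> V \<Longrightarrow> card (nbrs v) = \<Delta>"
  using regular bij_betw_same_card[OF nbrs_bij[of v]] by (auto simp: regular_graph_def)

text \<open>Counting only the edges into \<open>A\<close> allows to speak about the edges to settled vertices while the
  others have no colour yet.\<close>
definition coldeg :: "('a set \<Rightarrow> nat) \<Rightarrow> nat \<Rightarrow> 'a \<Rightarrow> 'a set \<Rightarrow> nat" where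
  "coldeg c j v A = card {u \<in> nbrs v \<inter> A. c {v, u} = j}"

lemma coldeg_cong:
  "(\<And>u. u \<in> nbrs v \<Longrightarrow> (u \<in> A \<and> c {v, u} = j) = (u \<in> B \<and> c' {v, u} = j))
    \<Longrightarrow> coldeg c j v A = coldeg c' j v B"
  unfolding coldeg_def by (rule arg_cong[of _ _ card]) auto

lemma coldeg_disjoint_Un: "A \<inter> B = {} \<Longrightarrow> coldeg c j v (A \<union> B) = coldeg c j v A + coldeg c j v B"
  unfolding coldeg_def by (subst card_Un_disjoint[symmetric])
    (auto simp: finite_nbrs intro!: arg_cong[of _ _ card])

lemma coldeg_pos: "coldeg c j v A \<noteq> 0 \<longleftrightarrow> (\<exists>u \<in> nbrs v \<inter> A. c {v, u} = j)"
  by (auto simp: coldeg_def finite_nbrs card_eq_0_iff)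

text \<open>The edges that have a colour when \<open>S\<close> is settled and \<open>X \<subseteq> S\<close> is exposed: settling a vertex
  fixes only its edges inside \<open>S\<close>, exposing it fixes all of them.\<close>
definition coloured :: "'a set \<Rightarrow> 'a set \<Rightarrow> 'a set set" where
  "coloured S X = {e \<in> E. e \<inter> X \<noteq> {} \<or> e \<subseteq> S}"

text \<open>All that its coloured edges reveal about a vertex \<open>y\<close> outside the settled set, once the exposed
  vertices \<open>X\<close> are known to be fixed.\<close>
definition trace :: "('a set \<Rightarrow> nat) \<Rightarrow> 'a set \<Rightarrow> 'a \<Rightarrow> 'a \<Rightarrow> nat option" where
  "trace c X y = (\<lambda>s. if s \<in> nbrs y \<inter> X then Some (c {y, s}) else None)"

definition twins :: "('a set \<Rightarrow> nat) \<Rightarrow> 'a set \<Rightarrow> 'a set \<Rightarrow> 'a \<Rightarrow> 'a set" where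
  "twins c S X y = {z \<in> V - S. trace c X z = trace c X y}"

lemma dom_trace: "dom (trace c X y) = nbrs y \<inter> X"
  by (auto simp: trace_def dom_def)

lemma trace_nbrs: "trace c X y = trace c X z \<Longrightarrow> nbrs y \<inter> X = nbrs z \<inter> X"
  by (metis dom_trace)

lemma trace_colour: assumes "trace c X y = trace c X z" "s \<in> nbrs y" "s \<in> X"
  shows "s \<in> nbrs z" "c {y, s} = c {z, s}"
proof -
  show "s \<in> nbrs z" using trace_nbrs[OF assms(1)] assms by auto
  then show "c {y, s} = c {z, s}"
    using fun_cong[OF assms(1), of s] assms by (simp add: trace_def)
qed

lemma trace_coldeg: assumes "trace c X y = trace c X z" shows "coldeg c j y X = coldeg c j z X"
  unfolding coldeg_def using trace_colour[OF assms] trace_colour[OF assms[symmetric]]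
  by (intro arg_cong[of _ _ card]) auto

lemma trace_eqI:
  assumes "\<And>s. s \<in> X \<Longrightarrow> s \<in> nbrs y \<longleftrightarrow> s \<in> nbrs z"
    and "\<And>s. s \<in> X \<Longrightarrow> s \<in> nbrs y \<Longrightarrow> c {y, s} = c {z, s}"
  shows "trace c X y = trace c X z"
  unfolding trace_def using assms by (intro ext) auto

lemma twins_subset_nbrs: "s \<in> nbrs x \<inter> X \<Longrightarrow> twins c S X x \<subseteq> nbrs s"
proof
  fix z assume s: "s \<in> nbrs x \<inter> X" and "z \<in> twins c S X x"
  then have "nbrs z \<inter> X = nbrs x \<inter> X" by (auto simp: twins_def dest: trace_nbrs)
  then have "s \<in> nbrs z" using s by auto
  then show "z \<in> nbrs s" by (simp only: nbrs_sym[of z s])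
qed

lemma finite_twins: "nbrs x \<inter> X \<noteq> {} \<Longrightarrow> finite (twins c S X x)"
  using twins_subset_nbrs[of _ x X c S] finite_subset[OF _ finite_nbrs] by blast

lemma self_in_twins: "x \<in> V - S \<Longrightarrow> x \<in> twins c S X x" by (simp add: twins_def)

text \<open>The value \<open>\<lceil>\<Delta>/2\<rceil>\<close> is squeezed from both sides: the red and the green class of neighbours of the
  root must both have at most \<open>(\<Delta> + 1)/2\<close> members to be settled, and \<open>2 ^ root_greens\<close> must exceed
  \<open>\<Delta> - 1\<close>.\<close>
definition root_greens :: nat where "root_greens = (\<Delta> + 1) div 2"

lemma degree_le_power_root_greens: "\<Delta> \<le> 2 ^ root_greens"
proof -
  have "n \<le> 2 ^ ((n + 1) div 2)" for n :: nat
  proof -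
    have "(n + 1) div 2 \<le> 2 ^ ((n + 1) div 2 - 1)" if "n > 0"
    proof -
      have "k + 1 \<le> 2 ^ k" for k :: nat by (induction k) auto
      from this[of "(n + 1) div 2 - 1"] that show ?thesis by simp
    qed
    then have "2 * ((n + 1) div 2) \<le> 2 ^ ((n + 1) div 2)" if "n > 0"
      using that by (cases "(n + 1) div 2") auto
    then show ?thesis by (cases "n > 0") auto
  qed
  then show ?thesis by (simp add: root_greens_def)
qed

text \<open>Each green edge at \<open>x\<close> has at least halved its class of twins. The class always contains \<open>x\<close>, so this
  bounds the number of green edges at a vertex that is settled last among its neighbours.\<close>
definition green_bounded :: "('a set \<Rightarrow> nat) \<Rightarrow> 'a set \<Rightarrow> 'a set \<Rightarrow> bool" where
  "green_bounded c S X \<longleftrightarrow> (\<forall>x \<in> V - S. nbrs x \<inter> X \<noteq> {} 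
     \<longrightarrow> card (twins c S X x) * 2 ^ coldeg c green x X \<le> \<Delta> - 1)"

lemma aut_nbrs:
  assumes "\<phi> \<in> automorphisms V E" "v \<in> V" "u \<in> V"
  shows "\<phi> u \<in> nbrs (\<phi> v) \<longleftrightarrow> u \<in> nbrs v"
  using assms by (auto simp: automorphisms_def nbrs_def)

lemma aut_perm: "\<phi> \<in> automorphisms V E \<Longrightarrow> \<phi> permutes V" by (simp add: automorphisms_def)

lemma aut_coldeg:
  assumes a: "\<phi> \<in> automorphisms V E" and p: "preserves_edge_colouring E c \<phi>" and v: "v \<in> V"
  shows "coldeg c j (\<phi> v) V = coldeg c j v V"
proof -
  have pv: "\<phi> permutes V" using a by (rule aut_perm)
  have c: "c {\<phi> v, \<phi> u} = c {v, u}" if "u \<in> nbrs v" for u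
    using p that by (force simp: preserves_edge_colouring_def nbrs_def)
  have "{u \<in> nbrs (\<phi> v) \<inter> V. c {\<phi> v, u} = j} = \<phi> ` {u \<in> nbrs v \<inter> V. c {v, u} = j}" (is "?A = ?B")
  proof
    show "?B \<subseteq> ?A" using c aut_nbrs[OF a v] permutes_in_image[OF pv] by auto
    show "?A \<subseteq> ?B"
    proof
      fix w assume w: "w \<in> ?A"
      then obtain u where u: "w = \<phi> u" "u \<in> V"
        using permutes_image[OF pv] by (metis (no_types, lifting) Int_iff imageE mem_Collect_eq)
      then have "u \<in> nbrs v" using w aut_nbrs[OF a v] by auto
      then show "w \<in> ?B" using u w c by auto
    qed
  qed
  moreover have "inj_on \<phi> {u \<in> nbrs v \<inter> V. c {v, u} = j}"
    by (rule inj_on_subset[OF permutes_inj_on[OF pv] subset_UNIV])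
  ultimately show ?thesis unfolding coldeg_def by (simp add: card_image)
qed

end

section \<open>Partial colourings\<close>

text \<open>A partial colouring \<open>c\<close> with settled set \<open>S\<close> and exposed set \<open>X\<close>; \<open>f s\<close> is the total number of red
  edges promised to the settled vertex \<open>s\<close>.

  \<^item> Outside their domains \<open>c\<close> and \<open>f\<close> are \<open>0\<close>, so that extension of partial colourings is
    antisymmetric. In particular an uncoloured edge has the value of red, but never that of blue or green.
  \<^item> \<open>attached\<close> limits the number of edges that an exposure has to colour to \<open>\<Delta> - 1\<close>.
  \<^item> \<open>target_lower\<close> and \<open>target_upper\<close> say that the promise to an unexposed vertex can be kept, and with few
    enough red edges to halve all classes of twins.
  \<^item> \<open>unlike_root\<close> gives the three ways in which a vertex will differ from the root: it has a
    blue edge; all its edges are coloured, and too few are green; or not all of the edges that it has left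
    are to be red, whence its exposure produces a blue one.
  \<^item> \<open>few_twins\<close> is the inequality that makes the next class of twins fit.
  \<^item> \<open>rigid\<close> speaks about all full colourings that extend \<open>c\<close> and keep the promises, because the
    red edges that separate twins may be coloured long after these are settled.\<close>
locale stage = rooted_regular +
  fixes S X :: "'a set" and c :: "'a set \<Rightarrow> nat" and f :: "'a \<Rightarrow> nat"
  assumes root_exposed: "r \<in> X" and exposed_settled: "X \<subseteq> S" and settled_in_V: "S \<subseteq> V"
    and three_colours: "c e < 3"
    and uncoloured_zero: "e \<notin> coloured S X \<Longrightarrow> c e = 0" and unsettled_zero: "s \<notin> S \<Longrightarrow> f s = 0"
    and root_colours: "coldeg c blue r V = 0" "coldeg c green r V = root_greens"
    and attached: "s \<in> S - X \<Longrightarrow> nbrs s \<inter> S \<noteq> {}"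
    and target_met: "s \<in> X \<Longrightarrow> coldeg c red s V = f s"
    and target_lower: "s \<in> S - X \<Longrightarrow> coldeg c red s S \<le> f s"
    and target_upper: "s \<in> S - X \<Longrightarrow> 2 * (f s - coldeg c red s S) \<le> card (nbrs s - S) + 1"
    and unlike_root: "s \<in> S - {r} \<Longrightarrow> (\<exists>u\<in>nbrs s. c {s, u} = blue)
        \<or> nbrs s \<subseteq> S \<and> coldeg c green s V < root_greens
        \<or> s \<notin> X \<and> f s - coldeg c red s S < card (nbrs s - S)"
    and few_twins: "x \<in> V - S \<Longrightarrow> nbrs x \<inter> X \<noteq> {} \<Longrightarrow> 2 * card (twins c S X x) + card (nbrs x \<inter> X) \<le> \<Delta> + 2"
    and rigid: "(\<And>e. e \<in> coloured S X \<Longrightarrow> c' e = c e) \<Longrightarrow> (\<And>s. s \<in> S \<Longrightarrow> coldeg c' red s V = f s) \<Longrightarrow>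
        \<phi> \<in> automorphisms V E \<Longrightarrow> preserves_edge_colouring E c' \<phi> \<Longrightarrow> \<phi> r = r \<Longrightarrow> s \<in> S \<Longrightarrow> \<phi> s = s"
begin

section \<open>Exposing a settled vertex\<close>

text \<open>Apply \<open>balanced_split\<close> to the outer neighbours of \<open>s\<close>, classified by their traces. There are at
  most \<open>\<Delta> - 1\<close> outer neighbours, which bounds the class with empty trace; the other classes are parts of
  classes of twins that already satisfy the bounds.\<close>
lemma expose:
  assumes s: "s \<in> S - X"
  obtains c' where "stage V E \<Delta> r S (insert s X) c' f" "\<And>e. e \<in> coloured S X \<Longrightarrow> c' e = c e"
    "green_bounded c S X \<Longrightarrow> green_bounded c' S (insert s X)"
proof -
  define Y where "Y = nbrs s - S"
  define q where "q = f s - coldeg c red s S"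
  have finY: "finite Y" by (simp add: Y_def finite_nbrs)
  have sV: "s \<in> V" using s settled_in_V by auto
  have rs: "r \<noteq> s" using s root_exposed by auto
  obtain h :: "'a \<Rightarrow> nat" where h: "\<And>y. h y < 3" "card {y \<in> Y. h y = red} = q"
    "\<And>k j. 2 * card {y \<in> Y. trace c X y = k \<and> h y = j} \<le> card {y \<in> Y. trace c X y = k} + 1"
    "\<And>k. 2 * card {y \<in> Y. trace c X y = k \<and> h y = green} \<le> card {y \<in> Y. trace c X y = k}"
    "q < card Y \<Longrightarrow> \<exists>y\<in>Y. h y = blue"
    using balanced_split[OF finY, of q "trace c X"] target_upper[OF s] by (auto simp: q_def Y_def)
  \<comment> \<open>an edge \<open>e\<close> at \<open>s\<close> that leaves \<open>S\<close> gets the colour of its other end, \<open>the_elem (e - {s})\<close>\<close>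
  define c' where "c' = (\<lambda>e. if s \<in> e \<and> e \<in> E \<and> \<not> e \<subseteq> S then h (the_elem (e - {s})) else c e)"
  have c'Y: "c' {s, y} = h y" "c' {y, s} = h y" if "y \<in> Y" for y
  proof -
    have "y \<noteq> s" "{s, y} \<in> E" "y \<notin> S" using that s by (auto simp: Y_def nbrs_def)
    moreover from this have "{s, y} - {s} = {y}" by auto
    ultimately show "c' {s, y} = h y" by (simp add: c'_def)
    then show "c' {y, s} = h y" by (simp add: insert_commute)
  qed
  have agree: "c' e = c e" if "e \<in> coloured S X" for e
  proof -
    have "e \<subseteq> S" if "s \<in> e" "e \<in> E"
      using \<open>e \<in> coloured S X\<close> that s exposed_settled by (elim edgeE) (auto simp: coloured_def)
    then show ?thesis by (auto simp: c'_def)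
  qed
  have other: "c' {v, u} = c {v, u}" if "v \<noteq> s" "u \<noteq> s" for u v
    using that by (simp add: c'_def)
  have inS: "c' {v, u} = c {v, u}" if "v \<in> S" "u \<in> S" for u v
    using that by (simp add: c'_def)
  have mono: "coloured S X \<subseteq> coloured S (insert s X)" by (auto simp: coloured_def)
  have atX: "c' {v, u} = c {v, u}" if "v \<in> X" "u \<in> nbrs v" for u v
    by (rule agree) (use that in \<open>auto simp: coloured_def nbrs_def\<close>)
  have coldegX: "coldeg c' j v A = coldeg c j v A" if "v \<in> X" for j v A
    by (rule coldeg_cong) (simp add: atX[OF that])
  have coldegS: "coldeg c' j v S = coldeg c j v S" if "v \<in> S" for j v
    by (rule coldeg_cong) (use inS[OF that] in auto)
  have coldeg_sV: "coldeg c' j s V = coldeg c j s S + card {y \<in> Y. h y = j}" for j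
  proof -
    have "coldeg c' j s V = coldeg c' j s S + coldeg c' j s (V - S)"
      using coldeg_disjoint_Un[of S "V - S" c' j s] settled_in_V by (simp add: Un_absorb1)
    moreover have "coldeg c' j s (V - S) = card {y \<in> Y. h y = j}"
      unfolding coldeg_def using c'Y nbrs_subset[of s]
      by (intro arg_cong[of _ _ card]) (auto simp: Y_def)
    ultimately show ?thesis using coldegS s by auto
  qed
  have trace': "trace c' (insert s X) y = (trace c X y)(s := if y \<in> Y then Some (h y) else None)"
    if y: "y \<in> V - S" for y
  proof
    fix t
    have "y \<noteq> s" using y s by auto
    moreover have "y \<in> Y \<longleftrightarrow> s \<in> nbrs y" using y by (auto simp: Y_def nbrs_sym)
    moreover have "t \<noteq> s \<Longrightarrow> c' {y, t} = c {y, t}" using \<open>y \<noteq> s\<close> by (rule other)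
    ultimately show "trace c' (insert s X) y t = ((trace c X y)(s := if y \<in> Y then Some (h y) else None)) t"
      using c'Y by (auto simp: trace_def)
  qed
  have trace_s: "trace c X y s = None" for y using s by (auto simp: trace_def)
  \<comment> \<open>the new trace records the colour of the edge to \<open>s\<close>, so the classes are cut by \<open>h\<close>\<close>
  have twins_Y: "twins c' S (insert s X) x = {y \<in> Y. trace c X y = trace c X x \<and> h y = h x}"
    if x: "x \<in> Y" for x
  proof -
    have xV: "x \<in> V - S" using x nbrs_subset[of s] by (auto simp: Y_def)
    have "trace c' (insert s X) z = trace c' (insert s X) x \<longleftrightarrow> z \<in> Y \<and> trace c X z = trace c X x \<and> h z = h x"
      if z: "z \<in> V - S" for z
    proof -
      have "(trace c X z)(s := a) = (trace c X x)(s := b) \<longleftrightarrow> a = b \<and> trace c X z = trace c X x" for a b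
        using trace_s by (metis fun_upd_idem fun_upd_same fun_upd_upd)
      then show ?thesis unfolding trace'[OF z] trace'[OF xV] using x by auto
    qed
    moreover have "Y \<subseteq> V - S" using nbrs_subset[of s] by (auto simp: Y_def)
    ultimately show ?thesis unfolding twins_def by auto
  qed
  have twins_sub: "twins c' S (insert s X) x \<subseteq> twins c S X x" if x: "x \<in> V - S" for x
  proof
    fix z assume z: "z \<in> twins c' S (insert s X) x"
    then have zV: "z \<in> V - S" by (simp add: twins_def)
    have "(trace c X z)(s := if z \<in> Y then Some (h z) else None) = (trace c X x)(s := if x \<in> Y then Some (h x) else None)"
      using z unfolding twins_def by (simp add: trace'[OF zV, symmetric] trace'[OF x, symmetric])
    then have "trace c X z = trace c X x" using trace_s by (metis fun_upd_idem fun_upd_upd)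
    then show "z \<in> twins c S X x" using zV by (simp add: twins_def)
  qed
  \<comment> \<open>\<open>s\<close> has a settled neighbour, so not all its neighbours are in \<open>Y\<close>\<close>
  have cardY: "card Y \<le> \<Delta> - 1"
  proof -
    have "Y \<subset> nbrs s" using attached[OF s] by (auto simp: Y_def)
    then have "card Y < \<Delta>" using psubset_card_mono[OF finite_nbrs] card_nbrs[OF sV] by metis
    then show ?thesis by simp
  qed
  have part: "card {y \<in> Y. trace c X y = trace c X x} \<le> card (twins c S X x)" if "nbrs x \<inter> X \<noteq> {}" for x
    by (rule card_mono) (use finite_twins[OF that] nbrs_subset[of s] in \<open>auto simp: twins_def Y_def\<close>)
  have partY: "card {y \<in> Y. trace c X y = k} \<le> \<Delta> - 1" for k
    using cardY card_mono[OF finY, of "{y \<in> Y. trace c X y = k}"] by (simp add: subset_iff)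
  have nbrs_x: "nbrs x \<inter> insert s X = insert s (nbrs x \<inter> X)" if "x \<in> Y" for x
    using that nbrs_sym by (auto simp: Y_def)
  have nbrs_x': "nbrs x \<inter> insert s X = nbrs x \<inter> X" if "x \<in> V - S" "x \<notin> Y" for x
    using that nbrs_sym[of s x] by (auto simp: Y_def)
  have coldeg2: "coldeg c' green x (insert s X) = coldeg c green x X + of_bool (h x = green)" if x: "x \<in> Y" for x
  proof -
    have xs: "x \<noteq> s" using x nbrs_irrefl by (auto simp: Y_def)
    have "coldeg c' green x (X \<union> {s}) = coldeg c' green x X + coldeg c' green x {s}"
      using s by (intro coldeg_disjoint_Un) auto
    moreover have "coldeg c' green x X = coldeg c green x X"
    proof (rule coldeg_cong)
      fix u assume "u \<in> nbrs x"
      show "(u \<in> X \<and> c' {x, u} = green) = (u \<in> X \<and> c {x, u} = green)"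
        using other[OF xs, of u] s by (cases "u = s") auto
    qed
    moreover have "{u \<in> nbrs x \<inter> {s}. c' {x, u} = green} = (if h x = green then {s} else {})"
      using x c'Y[OF x] nbrs_sym[of s x] by (auto simp: Y_def)
    then have "coldeg c' green x {s} = of_bool (h x = green)" by (simp add: coldeg_def)
    ultimately show ?thesis by simp
  qed
  have coldeg2': "coldeg c' green x (insert s X) = coldeg c green x X" if x: "x \<in> V - S" "x \<notin> Y" for x
  proof (rule coldeg_cong)
    fix u assume u: "u \<in> nbrs x"
    then have "u \<noteq> s" using x nbrs_sym by (auto simp: Y_def)
    moreover have "x \<noteq> s" using x s by auto
    ultimately show "(u \<in> insert s X \<and> c' {x, u} = green) = (u \<in> X \<and> c {x, u} = green)"
      using other by auto
  qed
  have "stage V E \<Delta> r S (insert s X) c' f"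
  proof
    show "r \<in> insert s X" "insert s X \<subseteq> S" "S \<subseteq> V" using root_exposed exposed_settled settled_in_V s by auto
    show "c' e < 3" for e using three_colours h(1) by (simp add: c'_def)
    show "c' e = 0" if "e \<notin> coloured S (insert s X)" for e
    proof -
      have "\<not> (s \<in> e \<and> e \<in> E \<and> \<not> e \<subseteq> S)" using that by (auto simp: coloured_def)
      then show ?thesis using uncoloured_zero[of e] that mono by (auto simp: c'_def)
    qed
    show "f s = 0" if "s \<notin> S" for s using unsettled_zero that .
    show "coldeg c' blue r V = 0" "coldeg c' green r V = root_greens" using root_colours coldegX[OF root_exposed] by auto
    show "nbrs t \<inter> S \<noteq> {}" if "t \<in> S - insert s X" for t using attached that by auto
    show "coldeg c' red t V = f t" if "t \<in> insert s X" for t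
    proof (cases "t = s")
      case True
      then show ?thesis using coldeg_sV[of 0] h(2) target_lower[OF s] by (simp add: q_def)
    next
      case False then show ?thesis using that target_met coldegX by auto
    qed
    show "coldeg c' red t S \<le> f t" if "t \<in> S - insert s X" for t
      using that target_lower[of t] coldegS[of t] by auto
    show "2 * (f t - coldeg c' red t S) \<le> card (nbrs t - S) + 1" if "t \<in> S - insert s X" for t
      using that target_upper[of t] coldegS[of t] by auto
    show "(\<exists>u\<in>nbrs t. c' {t, u} = blue) \<or> nbrs t \<subseteq> S \<and> coldeg c' green t V < root_greens
        \<or> t \<notin> insert s X \<and> f t - coldeg c' red t S < card (nbrs t - S)" if t: "t \<in> S - {r}" for t
      using unlike_root[OF t]
    proof (elim disjE conjE bexE)
      fix u assume "u \<in> nbrs t" "c {t, u} = blue"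
      moreover from this have "{t, u} \<in> coloured S X" using uncoloured_zero by fastforce
      ultimately show ?thesis using agree by metis
    next
      assume "nbrs t \<subseteq> S" "coldeg c green t V < root_greens"
      moreover from this have "coldeg c' green t V = coldeg c green t V"
        by (intro coldeg_cong) (use t inS in auto)
      ultimately show ?thesis by simp
    next
      assume a: "t \<notin> X" "f t - coldeg c red t S < card (nbrs t - S)"
      show ?thesis
      proof (cases "t = s")
        case True
        then obtain y where "y \<in> Y" "h y = blue" using a h(5) by (auto simp: q_def Y_def)
        then show ?thesis using True c'Y[of y] by (auto simp: Y_def)
      next
        case False then show ?thesis using a coldegS t by auto
      qed
    qed
    show "2 * card (twins c' S (insert s X) x) + card (nbrs x \<inter> insert s X) \<le> \<Delta> + 2"
      if x: "x \<in> V - S" "nbrs x \<inter> insert s X \<noteq> {}" for x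
    proof (cases "x \<in> Y")
      case True
      let ?k = "card {y \<in> Y. trace c X y = trace c X x}"
      have half: "2 * card (twins c' S (insert s X) x) \<le> ?k + 1"
        unfolding twins_Y[OF True] by (rule h(3))
      have cn: "card (nbrs x \<inter> insert s X) = Suc (card (nbrs x \<inter> X))"
        unfolding nbrs_x[OF True] using s finite_nbrs by (subst card_insert_disjoint) auto
      have "card (nbrs x \<inter> insert s X) \<le> \<Delta>"
        using card_mono[OF finite_nbrs, of "nbrs x \<inter> insert s X" x] card_nbrs x by auto
      then have ub: "Suc (card (nbrs x \<inter> X)) \<le> \<Delta>" using cn by simp
      show ?thesis
      proof (cases "nbrs x \<inter> X = {}")
        case True
        then show ?thesis using half cn partY[of "trace c X x"] degree_ge_2 by simp
      next
        case False
        have "?k \<le> card (twins c S X x)" using part[OF False] .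
        moreover have "2 * card (twins c S X x) + card (nbrs x \<inter> X) \<le> \<Delta> + 2" using few_twins[OF x(1) False] .
        ultimately show ?thesis using half cn ub by linarith
      qed
    next
      case False
      have "nbrs x \<inter> X \<noteq> {}" using nbrs_x'[OF x(1) False] x by auto
      moreover from this have "card (twins c' S (insert s X) x) \<le> card (twins c S X x)"
        using twins_sub[OF x(1)] finite_twins card_mono by metis
      ultimately show ?thesis using few_twins[OF x(1)] nbrs_x'[OF x(1) False] by fastforce
    qed
    show "\<phi> t = t"
      if "\<And>e. e \<in> coloured S (insert s X) \<Longrightarrow> d e = c' e" "\<And>s. s \<in> S \<Longrightarrow> coldeg d red s V = f s"
        "\<phi> \<in> automorphisms V E" "preserves_edge_colouring E d \<phi>" "\<phi> r = r" "t \<in> S" for d \<phi> t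
    proof (rule rigid[OF _ that(2-6)])
      show "d e = c e" if "e \<in> coloured S X" for e
        using \<open>\<And>e. e \<in> coloured S (insert s X) \<Longrightarrow> d e = c' e\<close>[of e] agree[OF that] that mono by auto
    qed
  qed
  moreover have "green_bounded c' S (insert s X)" if L: "green_bounded c S X"
    unfolding green_bounded_def
  proof (intro ballI impI)
    fix x assume x: "x \<in> V - S" "nbrs x \<inter> insert s X \<noteq> {}"
    show "card (twins c' S (insert s X) x) * 2 ^ coldeg c' green x (insert s X) \<le> \<Delta> - 1"
    proof (cases "x \<in> Y")
      case True
      let ?k = "card {y \<in> Y. trace c X y = trace c X x}"
      have "card (twins c' S (insert s X) x) * 2 ^ of_bool (h x = green) \<le> ?k"
      proof (cases "h x = green")
        case True then show ?thesis using h(4)[of "trace c X x"] twins_Y[OF \<open>x \<in> Y\<close>] by simp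
      next
        case False
        have "twins c' S (insert s X) x \<subseteq> {y \<in> Y. trace c X y = trace c X x}"
          using twins_Y[OF \<open>x \<in> Y\<close>] by auto
        then show ?thesis using False finY by (simp add: card_mono)
      qed
      then have "card (twins c' S (insert s X) x) * 2 ^ coldeg c' green x (insert s X) \<le> ?k * 2 ^ coldeg c green x X"
        unfolding coldeg2[OF True] by (simp add: power_add)
      also have "\<dots> \<le> \<Delta> - 1"
      proof (cases "nbrs x \<inter> X = {}")
        case True
        then have "coldeg c green x X = 0" by (simp add: coldeg_def)
        then show ?thesis using partY by simp
      next
        case False
        have "?k * 2 ^ coldeg c green x X \<le> card (twins c S X x) * 2 ^ coldeg c green x X"
          using part[OF False] by simp
        also have "\<dots> \<le> \<Delta> - 1" using L x False by (auto simp: green_bounded_def)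
        finally show ?thesis .
      qed
      finally show ?thesis .
    next
      case False
      have n: "nbrs x \<inter> X \<noteq> {}" using nbrs_x'[OF x(1) False] x by auto
      from this have "card (twins c' S (insert s X) x) \<le> card (twins c S X x)"
        using twins_sub[OF x(1)] finite_twins card_mono by metis
      then have "card (twins c' S (insert s X) x) * 2 ^ coldeg c green x X \<le> card (twins c S X x) * 2 ^ coldeg c green x X"
        by simp
      also have "\<dots> \<le> \<Delta> - 1" using L x(1) n by (auto simp: green_bounded_def)
      finally show ?thesis by (simp add: coldeg2'[OF x(1) False])
    qed
  qed
  ultimately show ?thesis using that agree by blast
qed

section \<open>Settling a class of twins\<close>

text \<open>Colour the edges inside the class by the threshold rule and promise the member with index \<open>i\<close> exactly
  \<open>i\<close> red edges besides those to \<open>S\<close>. An automorphism that fixes \<open>S\<close> maps the class to itself and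
  preserves red degrees, so it preserves the index. The premise \<open>terminal\<close> is needed when a vertex
  is settled with no uncoloured edge left: then nothing but its green degree tells it from the root.\<close>
lemma settle_twins:
  assumes XeqS: "X = S" and x: "x \<in> V - S" "nbrs x \<inter> S \<noteq> {}"
    and terminal: "nbrs x \<subseteq> S \<Longrightarrow> coldeg c green x V < root_greens"
  obtains c' f' where "stage V E \<Delta> r (S \<union> twins c S S x) S c' f'"
    "\<And>e. e \<in> coloured S S \<Longrightarrow> c' e = c e" "\<And>s. s \<in> S \<Longrightarrow> f' s = f s"
    "\<And>y. y \<in> V - (S \<union> twins c S S x) \<Longrightarrow> twins c' (S \<union> twins c S S x) S y \<subseteq> twins c S S y"
    "\<And>y. coldeg c' green y S = coldeg c green y S"
proof -
  define C where "C = twins c S S x"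
  define k where "k = card C"
  have finC: "finite C" unfolding C_def by (rule finite_twins[OF x(2)])
  have xC: "x \<in> C" using x by (simp add: C_def self_in_twins)
  have CV: "C \<subseteq> V" "C \<inter> S = {}" by (auto simp: C_def twins_def)
  have sigC: "trace c S u = trace c S x" if "u \<in> C" for u using that by (simp add: C_def twins_def)
  obtain idx where bij: "bij_betw idx C {0..<k}"
    using ex_bij_betw_finite_nat[OF finC] by (auto simp: k_def)
  have idx_lt: "idx u < k" if "u \<in> C" for u using bij that by (auto simp: bij_betw_def)
  have idx_inj: "inj_on idx C" using bij by (auto simp: bij_betw_def)
  define c' where "c' = (\<lambda>e. if e \<in> E \<and> e \<subseteq> C then (if k \<le> sum idx e then red else blue) else c e)"
  define f' where "f' = (\<lambda>u. if u \<in> C then coldeg c red x S + idx u else f u)"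
  have c'C: "c' {u, v} = (if k \<le> idx u + idx v then red else blue)" if "u \<in> C" "v \<in> C" "v \<in> nbrs u" for u v
  proof -
    have "u \<noteq> v" using that nbrs_irrefl by auto
    then show ?thesis using that by (simp add: c'_def nbrs_def)
  qed
  have c'o: "c' e = c e" if "\<not> e \<subseteq> C" for e using that by (auto simp: c'_def)
  have agree: "c' e = c e" if "e \<in> coloured S S" for e
  proof (rule c'o)
    show "\<not> e \<subseteq> C" using that CV by (auto simp: coloured_def elim!: edgeE)
  qed
  have atS: "c' {u, s} = c {u, s}" "c' {s, u} = c {s, u}" if "s \<in> S" for u s
    using that CV by (auto intro!: c'o)
  have sigS: "trace c' S = trace c S" by (intro ext) (simp add: trace_def atS)
  have coldegS: "coldeg c' j u S = coldeg c j u S" for j u by (rule coldeg_cong) (auto simp: atS)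
  have coldegS': "coldeg c' j s A = coldeg c j s A" if "s \<in> S" for j s A by (rule coldeg_cong) (auto simp: atS that)
  have mono: "coloured S S \<subseteq> coloured (S \<union> C) S" by (auto simp: coloured_def)
  have twins_sub: "twins c' (S \<union> C) S y \<subseteq> twins c S S y" for y
    by (auto simp: twins_def sigS)
  \<comment> \<open>the ends of the red and of the blue edges at \<open>u\<close> inside the class\<close>
  define A where "A = (\<lambda>u. {v \<in> nbrs u \<inter> C. k \<le> idx u + idx v})"
  define B where "B = (\<lambda>u. {v \<in> nbrs u \<inter> C. idx u + idx v < k})"
  have finAB: "finite (A u)" "finite (B u)" for u using finC by (auto simp: A_def B_def)
  have cA: "card (A u) \<le> idx u" if "u \<in> C" for u
  proof -
    have "card (A u) \<le> card {k - idx u..<k}"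
      by (rule card_inj_on_le[of idx])
        (use idx_lt idx_inj in \<open>auto simp: A_def intro: inj_on_subset\<close>)
    then show ?thesis using idx_lt[OF that] by simp
  qed
  have cB: "card (B u) \<le> k - idx u" if "u \<in> C" for u
  proof -
    have "card (B u) \<le> card {0..<k - idx u}"
      by (rule card_inj_on_le[of idx])
        (use idx_lt idx_inj in \<open>auto simp: B_def intro: inj_on_subset\<close>)
    then show ?thesis by simp
  qed
  define d where "d = card (nbrs x \<inter> S)"
  have small': "2 * k + d \<le> \<Delta> + 2"
    using few_twins[of x] x by (simp add: XeqS k_def C_def d_def)
  have dpos: "1 \<le> d" using x(2) finite_nbrs by (simp add: d_def Suc_le_eq card_gt_0_iff)
  have nbC: "card (nbrs u - (S \<union> C)) + card (A u) + card (B u) + d = \<Delta>" if u: "u \<in> C" for u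
  proof -
    have "nbrs u \<inter> S = nbrs x \<inter> S" using trace_nbrs[OF sigC[OF u]] .
    then have "card (nbrs u \<inter> S) = d" by (simp add: d_def)
    moreover have "nbrs u = (nbrs u - (S \<union> C)) \<union> A u \<union> B u \<union> (nbrs u \<inter> S)" by (auto simp: A_def B_def)
    moreover have "card ((nbrs u - (S \<union> C)) \<union> A u \<union> B u \<union> (nbrs u \<inter> S))
      = card (nbrs u - (S \<union> C)) + card (A u) + card (B u) + card (nbrs u \<inter> S)"
    proof -
      have "card ((nbrs u - (S \<union> C)) \<union> A u) = card (nbrs u - (S \<union> C)) + card (A u)"
        by (rule card_Un_disjoint) (use finAB finite_nbrs in \<open>auto simp: A_def\<close>)
      moreover have "card ((nbrs u - (S \<union> C)) \<union> A u \<union> B u) = card ((nbrs u - (S \<union> C)) \<union> A u) + card (B u)"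
        by (rule card_Un_disjoint) (use finAB finite_nbrs in \<open>auto simp: A_def B_def\<close>)
      moreover have "card ((nbrs u - (S \<union> C)) \<union> A u \<union> B u \<union> (nbrs u \<inter> S))
          = card ((nbrs u - (S \<union> C)) \<union> A u \<union> B u) + card (nbrs u \<inter> S)"
        by (rule card_Un_disjoint) (use CV finAB finite_nbrs in \<open>auto simp: A_def B_def\<close>)
      ultimately show ?thesis by simp
    qed
    ultimately show ?thesis using card_nbrs[of u] u CV by auto
  qed
  have red: "coldeg c' red u (S \<union> C) = coldeg c red x S + card (A u)" if u: "u \<in> C" for u
  proof -
    have "coldeg c' red u (S \<union> C) = coldeg c' red u S + coldeg c' red u C"
      using CV by (intro coldeg_disjoint_Un) auto
    moreover have "coldeg c' red u S = coldeg c red x S" using coldegS trace_coldeg[OF sigC[OF u]] by metis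
    moreover have "coldeg c' red u C = card (A u)" unfolding coldeg_def A_def
      by (rule arg_cong[of _ _ card]) (use c'C[OF u] in \<open>auto split: if_splits\<close>)
    ultimately show ?thesis by simp
  qed
  have SS: "S \<union> C - S = C" using CV by auto
  have "stage V E \<Delta> r (S \<union> C) S c' f'"
  proof
    show "r \<in> S" "S \<subseteq> S \<union> C" "S \<union> C \<subseteq> V" using root_exposed exposed_settled settled_in_V CV by auto
    then have rS: "r \<in> S" by simp
    show "c' e < 3" for e using three_colours by (simp add: c'_def)
    show "c' e = 0" if "e \<notin> coloured (S \<union> C) S" for e
    proof -
      have "\<not> (e \<in> E \<and> e \<subseteq> C)" using that by (auto simp: coloured_def)
      moreover have "c e = 0" using uncoloured_zero[of e] that mono XeqS by auto
      ultimately show ?thesis by (auto simp: c'_def)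
    qed
    show "f' s = 0" if "s \<notin> S \<union> C" for s using unsettled_zero[of s] that by (simp add: f'_def)
    show "coldeg c' blue r V = 0" "coldeg c' green r V = root_greens" using root_colours coldegS'[OF rS] by auto
    show "nbrs u \<inter> (S \<union> C) \<noteq> {}" if "u \<in> S \<union> C - S" for u
      using that trace_nbrs[OF sigC[of u]] x(2) SS by auto
    show "coldeg c' red s V = f' s" if "s \<in> S" for s
      using target_met[of s] that coldegS' CV XeqS by (auto simp: f'_def)
    show "coldeg c' red u (S \<union> C) \<le> f' u" if "u \<in> S \<union> C - S" for u
      using that cA[of u] red[of u] SS by (simp add: f'_def)
    show "2 * (f' u - coldeg c' red u (S \<union> C)) \<le> card (nbrs u - (S \<union> C)) + 1" if "u \<in> S \<union> C - S" for u
    proof -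
      have u: "u \<in> C" using that by auto
      show ?thesis
        using red[OF u] cA[OF u] cB[OF u] nbC[OF u] small' idx_lt[OF u] dpos u by (simp add: f'_def)
    qed
    show "(\<exists>v\<in>nbrs u. c' {u, v} = blue) \<or> nbrs u \<subseteq> S \<union> C \<and> coldeg c' green u V < root_greens
        \<or> u \<notin> S \<and> f' u - coldeg c' red u (S \<union> C) < card (nbrs u - (S \<union> C))" if u: "u \<in> S \<union> C - {r}" for u
    proof (cases "u \<in> S")
      case True
      then have "u \<in> S - {r}" using u by auto
      from unlike_root[OF this] True show ?thesis using XeqS atS coldegS' by auto
    next
      case False
      then have uC: "u \<in> C" using u by auto
      show ?thesis
      proof (cases "B u = {}")
        case True
        show ?thesis
        proof (rule ccontr)
          assume neg: "\<not> ?thesis"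
          then have "card (nbrs u - (S \<union> C)) \<le> idx u - card (A u)"
            using False uC red[OF uC] by (auto simp: f'_def not_less)
          then have "\<Delta> - d \<le> idx u" using nbC[OF uC] cA[OF uC] True by simp
          \<comment> \<open>without blue edges in \<open>C\<close> and with only red ones to come, \<open>2k + d \<le> \<Delta> + 2\<close> forces \<open>k = 1\<close> and \<open>d = \<Delta>\<close>\<close>
          then have k1: "k = 1" "\<Delta> = d"
            using small' idx_lt[OF uC] nbC[OF uC] by linarith+
          then have "u = x" using uC xC by (metis card_1_singletonE k_def singletonD)
          have "nbrs x \<inter> S = nbrs x"
            using k1 card_nbrs[of x] x finite_nbrs d_def by (intro card_subset_eq) auto
          then have "nbrs x \<subseteq> S" by auto
          moreover from this have "coldeg c' green x V = coldeg c green x V"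
            by (intro coldeg_cong) (auto simp: atS)
          ultimately show False using neg terminal \<open>u = x\<close> by auto
        qed
      next
        case False
        then obtain v where "v \<in> nbrs u \<inter> C" "idx u + idx v < k" by (auto simp: B_def)
        then have "v \<in> nbrs u" "c' {u, v} = blue" using c'C[OF uC, of v] by auto
        then show ?thesis by auto
      qed
    qed
    show "2 * card (twins c' (S \<union> C) S y) + card (nbrs y \<inter> S) \<le> \<Delta> + 2"
      if "y \<in> V - (S \<union> C)" "nbrs y \<inter> S \<noteq> {}" for y
    proof -
      have "card (twins c' (S \<union> C) S y) \<le> card (twins c S S y)"
        by (rule card_mono[OF finite_twins[OF that(2)] twins_sub])
      then show ?thesis using few_twins[of y] that XeqS by auto
    qed
    show "\<phi> t = t"
      if c'': "\<And>e. e \<in> coloured (S \<union> C) S \<Longrightarrow> c'' e = c' e"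
        and cn: "\<And>s. s \<in> S \<union> C \<Longrightarrow> coldeg c'' red s V = f' s"
        and \<phi>: "\<phi> \<in> automorphisms V E" "preserves_edge_colouring E c'' \<phi>" "\<phi> r = r"
        and t: "t \<in> S \<union> C" for c'' \<phi> t
    proof -
      have c''S: "c'' e = c e" if "e \<in> coloured S S" for e
        using c''[of e] agree[OF that] that mono by auto
      have fixS: "\<phi> s = s" if "s \<in> S" for s
      proof (rule rigid[OF _ _ \<phi> that])
        show "c'' e = c e" if "e \<in> coloured S X" for e using c''S that XeqS by simp
        show "coldeg c'' red s V = f s" if "s \<in> S" for s using cn[of s] that CV by (auto simp: f'_def)
      qed
      show ?thesis
      proof (cases "t \<in> S")
        case True then show ?thesis by (rule fixS)
      next
        case False
        then have tC: "t \<in> C" using t by auto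
        then have tV: "t \<in> V" using CV by auto
        have perm: "\<phi> permutes V" using aut_perm[OF \<phi>(1)] .
        have inj: "inj \<phi>" using permutes_inj[OF perm] .
        have "\<phi> t \<in> V" using tV permutes_in_image[OF perm] by simp
        moreover have "\<phi> t \<notin> S" using fixS[of "\<phi> t"] False inj by (metis injD)
        moreover have "trace c S (\<phi> t) = trace c S t"
        proof (rule trace_eqI)
          fix s assume s: "s \<in> S"
          then have sV: "s \<in> V" using settled_in_V by auto
          show nbrs: "s \<in> nbrs (\<phi> t) \<longleftrightarrow> s \<in> nbrs t"
            using aut_nbrs[OF \<phi>(1) tV sV] fixS[OF s] by simp
          assume "s \<in> nbrs (\<phi> t)"
          with nbrs have "s \<in> nbrs t" by simp
          then have e: "{t, s} \<in> E" by (simp add: nbrs_def)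
          then have e': "{\<phi> t, s} \<in> E" using nbrs \<open>s \<in> nbrs t\<close> by (simp add: nbrs_def)
          have "c'' {\<phi> t, s} = c'' {t, s}"
            using \<phi>(2) e fixS[OF s] by (force simp: preserves_edge_colouring_def)
          moreover have "c'' {\<phi> t, s} = c {\<phi> t, s}" by (rule c''S) (use s e' in \<open>auto simp: coloured_def\<close>)
          moreover have "c'' {t, s} = c {t, s}" by (rule c''S) (use s e in \<open>auto simp: coloured_def\<close>)
          ultimately show "c {\<phi> t, s} = c {t, s}" by simp
        qed
        ultimately have \<phi>C: "\<phi> t \<in> C" using sigC[OF tC] by (simp add: C_def twins_def)
        have "f' (\<phi> t) = f' t"
          using cn[of t] cn[of "\<phi> t"] \<phi>C tC aut_coldeg[OF \<phi>(1,2) tV] by simp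
        then have "idx (\<phi> t) = idx t" using \<phi>C tC by (simp add: f'_def)
        then show ?thesis using idx_inj \<phi>C tC by (auto simp: inj_on_def)
      qed
    qed
  qed
  moreover have "f' s = f s" if "s \<in> S" for s using that CV by (auto simp: f'_def)
  ultimately show ?thesis using that[of c' f'] agree twins_sub coldegS by (simp add: C_def)
qed

end

section \<open>Unions of chains of partial colourings\<close>

record 'a partial_colouring =
  settled :: "'a set"
  exposed :: "'a set"
  colour :: "'a set \<Rightarrow> nat"
  target :: "'a \<Rightarrow> nat"

context rooted_regular
begin

definition admissible :: "'a partial_colouring \<Rightarrow> bool" where
  "admissible p \<longleftrightarrow> stage V E \<Delta> r (settled p) (exposed p) (colour p) (target p)
     \<and> green_bounded (colour p) (settled p) (exposed p)"

abbreviation coloured_edges :: "'a partial_colouring \<Rightarrow> 'a set set" where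
  "coloured_edges p \<equiv> coloured (settled p) (exposed p)"

definition extends :: "'a partial_colouring \<Rightarrow> 'a partial_colouring \<Rightarrow> bool" where
  "extends p q \<longleftrightarrow> settled p \<subseteq> settled q \<and> exposed p \<subseteq> exposed q
     \<and> (\<forall>e\<in>coloured_edges p. colour q e = colour p e) \<and> (\<forall>s\<in>settled p. target q s = target p s)"

lemma coloured_mono: "S \<subseteq> S' \<Longrightarrow> X \<subseteq> X' \<Longrightarrow> coloured S X \<subseteq> coloured S' X'"
  by (auto simp: coloured_def)

lemma extends_refl: "extends p p" by (simp add: extends_def)

lemma extends_trans: "extends p q \<Longrightarrow> extends q s \<Longrightarrow> extends p s"
  using coloured_mono[of "settled p" "settled q" "exposed p" "exposed q"]
  unfolding extends_def by (smt (verit) subset_eq)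

lemma extends_antisym:
  assumes "admissible p" "admissible q" "extends p q" "extends q p" shows "p = q"
proof -
  interpret p: stage V E \<Delta> r "settled p" "exposed p" "colour p" "target p"
    using assms by (simp add: admissible_def)
  interpret q: stage V E \<Delta> r "settled q" "exposed q" "colour q" "target q"
    using assms by (simp add: admissible_def)
  have eq: "settled p = settled q" "exposed p = exposed q"
    using assms by (auto simp: extends_def)
  have "colour p e = colour q e" for e
    using assms p.uncoloured_zero[of e] q.uncoloured_zero[of e] eq by (cases "e \<in> coloured_edges p") (auto simp: extends_def)
  moreover have "target p s = target q s" for s
    using assms p.unsettled_zero[of s] q.unsettled_zero[of s] eq by (cases "s \<in> settled p") (auto simp: extends_def)
  ultimately show ?thesis using eq by (intro partial_colouring.equality) auto
qed

text \<open>Each invariant other than \<open>rigid\<close> concerns a single edge, vertex or class of twins, and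
  thereby a finite set \<open>W\<close> of vertices. Some member of the chain already agrees with the union on \<open>W\<close>, so
  the invariant is inherited from it. The invariant \<open>rigid\<close> passes to the union because a colouring that
  extends the union extends every member.\<close>
lemma chain_upper_bound:
  assumes ne: "K \<noteq> {}" and admissible: "\<And>p. p \<in> K \<Longrightarrow> admissible p"
    and chain: "\<And>p q. p \<in> K \<Longrightarrow> q \<in> K \<Longrightarrow> extends p q \<or> extends q p"
  shows "\<exists>u. admissible u \<and> (\<forall>p\<in>K. extends p u)"
proof -
  have st: "stage V E \<Delta> r (settled p) (exposed p) (colour p) (target p)" if "p \<in> K" for p
    using admissible that by (simp add: admissible_def)
  define S where "S = (\<Union>p\<in>K. settled p)"
  define X where "X = (\<Union>p\<in>K. exposed p)"
  define c where "c = (\<lambda>e. if \<exists>p\<in>K. e \<in> coloured_edges p then colour (SOME p. p \<in> K \<and> e \<in> coloured_edges p) e else 0)"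
  define f where "f = (\<lambda>s. if s \<in> S then target (SOME p. p \<in> K \<and> s \<in> settled p) s else 0)"
  have cK: "c e = colour p e" if "p \<in> K" "e \<in> coloured_edges p" for p e
  proof -
    define q where "q = (SOME p. p \<in> K \<and> e \<in> coloured_edges p)"
    have "q \<in> K \<and> e \<in> coloured_edges q" unfolding q_def by (rule someI[of _ p]) (use that in auto)
    moreover have "c e = colour q e" using that by (auto simp: c_def q_def)
    ultimately show ?thesis using chain[of p q] that by (auto simp: extends_def)
  qed
  have fK: "f s = target p s" if "p \<in> K" "s \<in> settled p" for p s
  proof -
    define q where "q = (SOME p. p \<in> K \<and> s \<in> settled p)"
    have "q \<in> K \<and> s \<in> settled q" unfolding q_def by (rule someI[of _ p]) (use that in auto)
    moreover have "f s = target q s" using that by (auto simp: f_def q_def S_def)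
    ultimately show ?thesis using chain[of p q] that by (auto simp: extends_def)
  qed
  have sub: "settled p \<subseteq> S" "exposed p \<subseteq> X" if "p \<in> K" for p using that by (auto simp: S_def X_def)
  have colsub: "coloured_edges p \<subseteq> coloured S X" if "p \<in> K" for p
    using coloured_mono sub[OF that] by blast
  have exposed_settled: "X \<subseteq> S" using stage.exposed_settled[OF st] by (force simp: S_def X_def)
  have local: "\<exists>p\<in>K. S \<inter> W = settled p \<inter> W \<and> X \<inter> W = exposed p \<inter> W" if "finite W" for W
    using that
  proof (induction W rule: finite_induct)
    case empty then show ?case using ne by auto
  next
    case (insert w W)
    then obtain p where p: "p \<in> K" "S \<inter> W = settled p \<inter> W" "X \<inter> W = exposed p \<inter> W" by blast
    have "\<exists>q\<in>K. (w \<in> S \<longrightarrow> w \<in> settled q) \<and> (w \<in> X \<longrightarrow> w \<in> exposed q)"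
    proof (cases "w \<in> X")
      case True
      then show ?thesis using stage.exposed_settled[OF st] by (force simp: X_def)
    next
      case False
      then show ?thesis using ne by (auto simp: S_def)
    qed
    then obtain q where q: "q \<in> K" "w \<in> S \<longrightarrow> w \<in> settled q" "w \<in> X \<longrightarrow> w \<in> exposed q" by blast
    obtain m where m: "m \<in> K" "extends p m" "extends q m"
      using chain[OF p(1) q(1)] p(1) q(1) extends_refl by blast
    then have "settled p \<subseteq> settled m" "exposed p \<subseteq> exposed m" "settled q \<subseteq> settled m" "exposed q \<subseteq> exposed m"
      by (auto simp: extends_def)
    then have "S \<inter> insert w W = settled m \<inter> insert w W \<and> X \<inter> insert w W = exposed m \<inter> insert w W"
      using p q sub[OF m(1)] by blast
    then show ?case using m by blast
  qed
  have col: "c e = colour p e"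
    if p: "p \<in> K" "S \<inter> W = settled p \<inter> W" "X \<inter> W = exposed p \<inter> W" and e: "e \<subseteq> W" for p W e
  proof (cases "e \<in> coloured_edges p")
    case True then show ?thesis using cK p by auto
  next
    case False
    have "e \<notin> coloured S X" using False p e unfolding coloured_def by blast
    then have "\<not> (\<exists>q\<in>K. e \<in> coloured_edges q)" using colsub by blast
    then have "c e = 0" unfolding c_def by (simp only: if_False)
    then show ?thesis using stage.uncoloured_zero[OF st[OF p(1)] False] by simp
  qed
  have at_vertex: "\<exists>p\<in>K. (v \<in> S \<longleftrightarrow> v \<in> settled p) \<and> (v \<in> X \<longleftrightarrow> v \<in> exposed p)
      \<and> (\<forall>u\<in>nbrs v. c {v, u} = colour p {v, u}) \<and> nbrs v \<inter> S = nbrs v \<inter> settled p" for v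
  proof -
    have fin: "finite (insert v (nbrs v))" using finite_nbrs by simp
    obtain p where p: "p \<in> K" "S \<inter> insert v (nbrs v) = settled p \<inter> insert v (nbrs v)"
        "X \<inter> insert v (nbrs v) = exposed p \<inter> insert v (nbrs v)" using local[OF fin] by blast
    have "\<forall>u\<in>nbrs v. c {v, u} = colour p {v, u}" using col[OF p] by auto
    moreover have "(v \<in> S \<longleftrightarrow> v \<in> settled p) \<and> (v \<in> X \<longleftrightarrow> v \<in> exposed p) \<and> nbrs v \<inter> S = nbrs v \<inter> settled p"
      using p(2,3) by blast
    ultimately show ?thesis using p(1) by blast
  qed
  have at_twins: "\<exists>p\<in>K. x \<notin> settled p \<and> nbrs x \<inter> X = nbrs x \<inter> exposed p
      \<and> twins c S X x = twins (colour p) (settled p) (exposed p) x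
      \<and> (\<forall>u\<in>nbrs x. c {x, u} = colour p {x, u})"
    if x: "x \<in> V - S" "nbrs x \<inter> X \<noteq> {}" for x
  proof -
    obtain t where t: "t \<in> nbrs x" "t \<in> X" using x by blast
    \<comment> \<open>twins of \<open>x\<close> are neighbours of \<open>t\<close>, so their traces only depend on \<open>W\<close>\<close>
    define W where "W = insert x (nbrs x) \<union> nbrs t \<union> (\<Union>y\<in>nbrs t. nbrs y)"
    have "finite W" using finite_nbrs by (simp add: W_def)
    then obtain p where p: "p \<in> K" "S \<inter> W = settled p \<inter> W" "X \<inter> W = exposed p \<inter> W"
      using local by blast
    have cW: "c {y, u} = colour p {y, u}" if "y \<in> nbrs t" "u \<in> nbrs y" for y u
      using col[OF p, of "{y, u}"] that by (auto simp: W_def)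
    have xt: "x \<in> nbrs t" using t(1) nbrs_sym[of t x] by simp
    have sigs: "trace c X y = trace (colour p) (exposed p) y" if y: "y \<in> nbrs t" for y
    proof
      fix s
      have "nbrs y \<subseteq> W" using y by (auto simp: W_def)
      then have "nbrs y \<inter> X = nbrs y \<inter> exposed p" using p(3) by blast
      then show "trace c X y s = trace (colour p) (exposed p) y s"
        using cW[OF y] by (auto simp: trace_def)
    qed
    have nbrs_x: "nbrs x \<inter> X = nbrs x \<inter> exposed p" using p(3) by (auto simp: W_def)
    have sub1: "twins c S X x \<subseteq> nbrs t" by (rule twins_subset_nbrs) (use t in auto)
    have sub2: "twins (colour p) (settled p) (exposed p) x \<subseteq> nbrs t"
      by (rule twins_subset_nbrs) (use t nbrs_x in auto)
    have "z \<in> twins c S X x \<longleftrightarrow> z \<in> twins (colour p) (settled p) (exposed p) x" if z: "z \<in> nbrs t" for z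
    proof -
      have "z \<in> S \<longleftrightarrow> z \<in> settled p" using p(2) z by (auto simp: W_def)
      then show ?thesis using sigs[OF z] sigs[OF xt] by (simp add: twins_def)
    qed
    then have "twins c S X x = twins (colour p) (settled p) (exposed p) x" using sub1 sub2 by blast
    moreover have "x \<notin> settled p" using x p sub by blast
    ultimately show ?thesis using p(1) nbrs_x cW[OF xt] by blast
  qed
  obtain p0 where p0: "p0 \<in> K" using ne by blast
  have settled_in_V: "S \<subseteq> V" using stage.settled_in_V[OF st] by (auto simp: S_def)
  have coldegV: "coldeg c j v A = coldeg d j v B"
    if "\<forall>u\<in>nbrs v. c {v, u} = d {v, u}" "nbrs v \<inter> A = nbrs v \<inter> B" for d :: "'a set \<Rightarrow> nat" and j v A B
    by (rule coldeg_cong) (use that in auto)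
  have "stage V E \<Delta> r S X c f"
  proof
    show "r \<in> X" using stage.root_exposed[OF st[OF p0]] sub[OF p0] by auto
    show "X \<subseteq> S" "S \<subseteq> V" by fact+
    show "c e < 3" for e
    proof (cases "\<exists>p\<in>K. e \<in> coloured_edges p")
      case True
      then obtain p where "p \<in> K" "e \<in> coloured_edges p" by blast
      then show ?thesis using cK[of p e] stage.three_colours[OF st, of p e] by simp
    next
      case False
      then have "c e = 0" unfolding c_def by (simp only: if_False)
      then show ?thesis by simp
    qed
    show "c e = 0" if "e \<notin> coloured S X" for e
    proof -
      have "\<not> (\<exists>q\<in>K. e \<in> coloured_edges q)" using colsub that by blast
      then show ?thesis unfolding c_def by (simp only: if_False)
    qed
    show "f s = 0" if "s \<notin> S" for s using that by (simp add: f_def)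
    show "coldeg c blue r V = 0" "coldeg c green r V = root_greens"
    proof -
      obtain p where "p \<in> K" "\<forall>u\<in>nbrs r. c {r, u} = colour p {r, u}" using at_vertex[of r] by blast
      then show "coldeg c blue r V = 0" "coldeg c green r V = root_greens"
        using stage.root_colours[OF st, of p] coldegV[of r "colour p" V V] by auto
    qed
    show "nbrs s \<inter> S \<noteq> {}" if s: "s \<in> S - X" for s
    proof -
      obtain p where "p \<in> K" "s \<in> settled p" "s \<notin> exposed p" "nbrs s \<inter> S = nbrs s \<inter> settled p"
        using at_vertex[of s] s by blast
      then show ?thesis using stage.attached[OF st, of p s] by auto
    qed
    show "coldeg c red s V = f s" if s: "s \<in> X" for s
    proof -
      obtain p where p: "p \<in> K" "s \<in> exposed p" "\<forall>u\<in>nbrs s. c {s, u} = colour p {s, u}" "s \<in> settled p"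
        using at_vertex[of s] s exposed_settled by blast
      then show ?thesis
        using stage.target_met[OF st, of p s] coldegV[OF p(3), of V V] fK[of p s] by auto
    qed
    show "coldeg c red s S \<le> f s" "2 * (f s - coldeg c red s S) \<le> card (nbrs s - S) + 1" if s: "s \<in> S - X" for s
    proof -
      obtain p where p: "p \<in> K" "s \<in> settled p" "s \<notin> exposed p" "\<forall>u\<in>nbrs s. c {s, u} = colour p {s, u}"
          "nbrs s \<inter> S = nbrs s \<inter> settled p"
        using at_vertex[of s] s by blast
      moreover from p have "nbrs s - S = nbrs s - settled p" by blast
      ultimately show "coldeg c red s S \<le> f s" "2 * (f s - coldeg c red s S) \<le> card (nbrs s - S) + 1"
        using stage.target_lower[OF st, of p s] stage.target_upper[OF st, of p s] coldegV[OF p(4) p(5)] fK[of p s]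
        by auto
    qed
    show "(\<exists>u\<in>nbrs s. c {s, u} = blue)
        \<or> nbrs s \<subseteq> S \<and> coldeg c green s V < root_greens
        \<or> s \<notin> X \<and> f s - coldeg c red s S < card (nbrs s - S)" if s: "s \<in> S - {r}" for s
    proof -
      obtain p where p: "p \<in> K" "s \<in> settled p" "s \<in> X \<longleftrightarrow> s \<in> exposed p"
          "\<forall>u\<in>nbrs s. c {s, u} = colour p {s, u}" "nbrs s \<inter> S = nbrs s \<inter> settled p"
        using at_vertex[of s] s by blast
      moreover from p have "nbrs s - S = nbrs s - settled p" "nbrs s \<subseteq> S \<longleftrightarrow> nbrs s \<subseteq> settled p" by blast+
      moreover have "s \<in> settled p - {r}" using p s by auto
      ultimately show ?thesis
        using stage.unlike_root[OF st, of p s] coldegV[OF p(4) p(5)] coldegV[OF p(4), of V V] fK[of p s]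
        by auto
    qed
    show "2 * card (twins c S X x) + card (nbrs x \<inter> X) \<le> \<Delta> + 2" if x: "x \<in> V - S" "nbrs x \<inter> X \<noteq> {}" for x
      using at_twins[OF x] stage.few_twins[OF st, of _ x] x by fastforce
    show "\<phi> t = t"
      if d: "\<And>e. e \<in> coloured S X \<Longrightarrow> d e = c e" and n: "\<And>s. s \<in> S \<Longrightarrow> coldeg d red s V = f s"
        and \<phi>: "\<phi> \<in> automorphisms V E" "preserves_edge_colouring E d \<phi>" "\<phi> r = r" and t: "t \<in> S" for d \<phi> t
    proof -
      obtain p where p: "p \<in> K" "t \<in> settled p" using t by (auto simp: S_def)
      show ?thesis
      proof (rule stage.rigid[OF st[OF p(1)] _ _ \<phi> p(2)])
        show "d e = colour p e" if "e \<in> coloured_edges p" for e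
          using d[of e] cK[OF p(1) that] colsub[OF p(1)] that by auto
        show "coldeg d red s V = target p s" if "s \<in> settled p" for s
          using n[of s] fK[OF p(1) that] sub[OF p(1)] that by auto
      qed
    qed
  qed
  moreover have "green_bounded c S X" unfolding green_bounded_def
  proof (intro ballI impI)
    fix x assume x: "x \<in> V - S" "nbrs x \<inter> X \<noteq> {}"
    obtain p where p: "p \<in> K" "x \<notin> settled p" "nbrs x \<inter> X = nbrs x \<inter> exposed p"
      "twins c S X x = twins (colour p) (settled p) (exposed p) x" "\<forall>u\<in>nbrs x. c {x, u} = colour p {x, u}"
      using at_twins[OF x] by blast
    have "green_bounded (colour p) (settled p) (exposed p)" using admissible[OF p(1)] by (simp add: admissible_def)
    then show "card (twins c S X x) * 2 ^ coldeg c green x X \<le> \<Delta> - 1"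
      using p x coldegV[OF p(5) p(3)] by (auto simp: green_bounded_def)
  qed
  moreover have "extends p \<lparr>settled = S, exposed = X, colour = c, target = f\<rparr>" if "p \<in> K" for p
    using sub[OF that] cK[OF that] fK[OF that] by (simp add: extends_def)
  ultimately show ?thesis
    by (intro exI[of _ "\<lparr>settled = S, exposed = X, colour = c, target = f\<rparr>"]) (simp add: admissible_def)
qed

section \<open>The starting colouring and the final one\<close>

text \<open>Start with \<open>\<lceil>\<Delta>/2\<rceil>\<close> green and \<open>\<lfloor>\<Delta>/2\<rfloor>\<close> red edges at the root, and settle its green neighbours.
  Before this step, \<open>green_bounded\<close> fails at them. It holds for the red neighbours, as there are at
  most \<open>\<Delta> - 1\<close> of them. The assumption \<open>\<Delta> \<ge> 2\<close> ensures that none of the green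
  neighbours is settled with all its edges already coloured.\<close>
lemma admissible_exists: "\<exists>p. admissible p"
proof -
  obtain A where A: "A \<subseteq> nbrs r" "card A = root_greens"
  proof -
    have "root_greens \<le> card (nbrs r)" using card_nbrs[OF root_in] degree_ge_2 by (simp add: root_greens_def)
    then show ?thesis using that obtain_subset_with_card_n by metis
  qed
  have finA: "finite A" using A finite_nbrs finite_subset by auto
  define c where "c = (\<lambda>e. if e \<in> (\<lambda>a. {r, a}) ` A then green else red)"
  have c_root: "c {r, u} = (if u \<in> A then green else red)" for u
    by (auto simp: c_def doubleton_eq_iff)
  then have c_root': "c {u, r} = (if u \<in> A then green else red)" for u
    by (simp only: insert_commute[of u r])
  define f where "f = (\<lambda>s. if s = r then coldeg c red r V else 0)"
  have rgs: "2 * root_greens \<le> \<Delta> + 1" "\<Delta> \<le> 2 * root_greens" by (auto simp: root_greens_def)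
  have twins_sub: "twins c S {r} x \<subseteq> (if x \<in> A then A else nbrs r - A)" if "x \<in> nbrs r" for x S
  proof
    fix z assume "z \<in> twins c S {r} x"
    then have s: "trace c {r} x = trace c {r} z" by (simp add: twins_def)
    have "r \<in> nbrs x" using that nbrs_sym[of x r] by simp
    from trace_colour[OF s this] have "r \<in> nbrs z" "c {x, r} = c {z, r}" by auto
    moreover from this have "z \<in> nbrs r" using nbrs_sym[of z r] by simp
    ultimately show "z \<in> (if x \<in> A then A else nbrs r - A)" by (auto simp: c_root' split: if_splits)
  qed
  have cardB: "card (nbrs r - A) = \<Delta> - root_greens"
    using A card_nbrs[OF root_in] finA by (simp add: card_Diff_subset)
  have inter: "nbrs x \<inter> {r} \<noteq> {} \<longleftrightarrow> x \<in> nbrs r" for x using nbrs_sym[of x r] by auto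
  have st: "stage V E \<Delta> r {r} {r} c f"
  proof
    show "{r} \<subseteq> V" using root_in by simp
    show "c e < 3" for e by (simp add: c_def)
    show "c e = 0" if "e \<notin> coloured {r} {r}" for e
      using that A by (auto simp: c_def coloured_def nbrs_def)
    show "coldeg c blue r V = 0" by (simp add: coldeg_def c_root)
    have "{u \<in> nbrs r \<inter> V. c {r, u} = green} = A" using A nbrs_subset by (auto simp: c_root)
    then show "coldeg c green r V = root_greens" using A by (simp add: coldeg_def)
    show "2 * card (twins c {r} {r} x) + card (nbrs x \<inter> {r}) \<le> \<Delta> + 2"
      if x: "x \<in> V - {r}" "nbrs x \<inter> {r} \<noteq> {}" for x
    proof -
      have "x \<in> nbrs r" using x inter by simp
      then have "card (twins c {r} {r} x) \<le> card (if x \<in> A then A else nbrs r - A)"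
        by (intro card_mono twins_sub) (use finA finite_nbrs in auto)
      then have "card (twins c {r} {r} x) \<le> root_greens" using A cardB rgs by (auto split: if_splits)
      moreover have "card (nbrs x \<inter> {r}) \<le> 1" using card_mono[of "{r}" "nbrs x \<inter> {r}"] by simp
      ultimately show ?thesis using rgs by linarith
    qed
  qed (auto simp: f_def)
  interpret stage V E \<Delta> r "{r}" "{r}" c f by (rule st)
  have "root_greens > 0" using degree_ge_2 by (simp add: root_greens_def)
  then obtain x where x: "x \<in> A" using A by fastforce
  then have xn: "x \<in> nbrs r" using A by auto
  have xV: "x \<in> V - {r}" using xn nbrs_in_V nbrs_irrefl by auto
  have "\<not> nbrs x \<subseteq> {r}"
    using card_mono[of "{r}" "nbrs x"] card_nbrs[of x] xV degree_ge_2 by auto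
  moreover have "nbrs x \<inter> {r} \<noteq> {}" using inter xn by simp
  ultimately obtain c' f' where n: "stage V E \<Delta> r ({r} \<union> twins c {r} {r} x) {r} c' f'"
      "\<And>y. y \<in> V - ({r} \<union> twins c {r} {r} x) \<Longrightarrow> twins c' ({r} \<union> twins c {r} {r} x) {r} y \<subseteq> twins c {r} {r} y"
      "\<And>y. coldeg c' green y {r} = coldeg c green y {r}"
    using settle_twins[OF refl xV] by metis
  have "A \<subseteq> twins c {r} {r} x"
  proof
    fix z assume z: "z \<in> A"
    have "z \<in> nbrs r" using z A by auto
    moreover from this have "z \<in> V - {r}" using nbrs_in_V nbrs_irrefl by auto
    moreover have "trace c {r} z = trace c {r} x"
      using z x nbrs_sym[of z r] nbrs_sym[of x r] xn \<open>z \<in> nbrs r\<close> by (intro trace_eqI) (auto simp: c_root')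
    ultimately show "z \<in> twins c {r} {r} x" by (simp add: twins_def)
  qed
  then have green_bounded: "green_bounded c' ({r} \<union> twins c {r} {r} x) {r}"
    unfolding green_bounded_def
  proof (intro ballI impI)
    fix y assume y: "y \<in> V - ({r} \<union> twins c {r} {r} x)" "nbrs y \<inter> {r} \<noteq> {}"
    have yA: "y \<notin> A" using y \<open>A \<subseteq> twins c {r} {r} x\<close> by auto
    have "twins c' ({r} \<union> twins c {r} {r} x) {r} y \<subseteq> nbrs r - A"
      using n(2)[OF y(1)] twins_sub[of y "{r}"] y inter yA by auto
    then have "card (twins c' ({r} \<union> twins c {r} {r} x) {r} y) \<le> \<Delta> - root_greens"
      using card_mono[of "nbrs r - A"] finite_nbrs cardB by (metis finite_Diff)
    moreover have "coldeg c' green y {r} = 0" unfolding n(3) using yA by (auto simp: coldeg_def c_root')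
    ultimately show "card (twins c' ({r} \<union> twins c {r} {r} x) {r} y) * 2 ^ coldeg c' green y {r} \<le> \<Delta> - 1"
      using \<open>root_greens > 0\<close> by simp
  qed
  show ?thesis
    by (rule exI[of _ "\<lparr>settled = {r} \<union> twins c {r} {r} x, exposed = {r}, colour = c', target = f'\<rparr>"])
      (use n(1) green_bounded in \<open>simp add: admissible_def\<close>)
qed

lemma maximal_admissible:
  obtains p where "admissible p" "\<And>q. admissible q \<Longrightarrow> extends p q \<Longrightarrow> q = p"
proof -
  have "\<exists>m \<in> Collect admissible. \<forall>a \<in> Collect admissible. extends m a \<longrightarrow> a = m"
  proof (rule predicate_Zorn)
    show "partial_order_on (Collect admissible) (relation_of extends (Collect admissible))"
      by (rule partial_order_on_relation_ofI)
        (use extends_refl extends_trans extends_antisym in blast)+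
    fix K assume K: "K \<in> Chains (relation_of extends (Collect admissible))"
    show "\<exists>u\<in>Collect admissible. \<forall>a\<in>K. extends a u"
    proof (cases "K = {}")
      case True then show ?thesis using admissible_exists by auto
    next
      case False
      have "admissible p" if "p \<in> K" for p using K that by (auto simp: Chains_def relation_of_def)
      moreover have "extends p q \<or> extends q p" if "p \<in> K" "q \<in> K" for p q
        using K that by (auto simp: Chains_def relation_of_def)
      ultimately show ?thesis using chain_upper_bound[OF False] by auto
    qed
  qed
  then show ?thesis using that by auto
qed

text \<open>In a maximal partial colouring no settled vertex is left to be exposed. Nor is a vertex left to be
  settled, since by connectedness one of them would have a settled neighbour, and its class of twins could
  be settled. So all edges are coloured and all promises are kept, \<open>unlike_root\<close> makes every
  colour-preserving automorphism fix the root, and \<open>rigid\<close> makes it the identity.\<close>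
lemma distinguishing_three_colouring:
  "\<exists>c \<in> E \<rightarrow> {..<3::nat}. distinguishing_edge_colouring V E c"
proof -
  obtain p where p: "admissible p" and max: "\<And>q. admissible q \<Longrightarrow> extends p q \<Longrightarrow> q = p"
    using maximal_admissible by blast
  define S X c f where "S = settled p" and "X = exposed p" and "c = colour p" and "f = target p"
  note defs = this
  interpret stage V E \<Delta> r S X c f using p by (simp add: admissible_def defs)
  have green_bounded: "green_bounded c S X" using p by (simp add: admissible_def defs)
  have XeqS: "X = S"
  proof (rule ccontr)
    assume "X \<noteq> S"
    then obtain s where s: "s \<in> S - X" using exposed_settled by blast
    obtain c' where n: "stage V E \<Delta> r S (insert s X) c' f" "\<And>e. e \<in> coloured S X \<Longrightarrow> c' e = c e"
        "green_bounded c' S (insert s X)" using expose[OF s] green_bounded by metis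
    let ?q = "\<lparr>settled = S, exposed = insert s X, colour = c', target = f\<rparr>"
    have "admissible ?q" using n by (simp add: admissible_def)
    moreover have "extends p ?q" using n(2) by (auto simp: extends_def defs)
    ultimately have "?q = p" by (rule max)
    then have "exposed ?q = X" unfolding defs by simp
    then show False using s by auto
  qed
  have SeqV: "S = V"
  proof (rule ccontr)
    assume "S \<noteq> V"
    then obtain v where v: "v \<in> V" "v \<notin> S" using settled_in_V by blast
    have "\<exists>x\<in>V - S. nbrs x \<inter> S \<noteq> {}"
    proof (rule ccontr)
      assume no: "\<not> ?thesis"
      have "(r, v) \<in> {(x, y). {x, y} \<in> E}\<^sup>*" using connected root_in v by (simp add: connected_graph_def)
      then have "v \<in> S"
      proof (induction rule: rtrancl_induct)
        case base then show ?case using root_exposed exposed_settled by auto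
      next
        case (step y z)
        then have "z \<in> nbrs y" by (simp add: nbrs_def)
        then have "y \<in> nbrs z" "z \<in> V" using nbrs_sym[of z y] nbrs_in_V by auto
        then show ?case using no step by auto
      qed
      then show False using v by simp
    qed
    then obtain x where x: "x \<in> V - S" "nbrs x \<inter> S \<noteq> {}" by blast
    \<comment> \<open>\<open>x\<close> is in its own class, so \<open>green_bounded\<close> gives \<open>2 ^ g \<le> \<Delta> - 1 < 2 ^ root_greens\<close>\<close>
    have terminal: "coldeg c green x V < root_greens" if "nbrs x \<subseteq> S"
    proof -
      have "coldeg c green x V = coldeg c green x S" by (rule coldeg_cong) (use that settled_in_V in auto)
      moreover have "card (twins c S S x) * 2 ^ coldeg c green x S \<le> \<Delta> - 1"
        using green_bounded x XeqS by (auto simp: green_bounded_def)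
      moreover have "card (twins c S S x) \<ge> 1"
        using self_in_twins[OF x(1)] finite_twins[OF x(2)] by (simp add: Suc_le_eq card_gt_0_iff) blast
      ultimately have "2 ^ coldeg c green x V \<le> \<Delta> - 1"
        by (metis le_trans mult_le_mono1 nat_mult_1)
      then have "(2::nat) ^ coldeg c green x V < 2 ^ root_greens"
        using degree_le_power_root_greens degree_ge_2 by linarith
      then show ?thesis by simp
    qed
    obtain c' f' where n: "stage V E \<Delta> r (S \<union> twins c S S x) S c' f'"
      "\<And>e. e \<in> coloured S S \<Longrightarrow> c' e = c e" "\<And>s. s \<in> S \<Longrightarrow> f' s = f s"
      "\<And>y. y \<in> V - (S \<union> twins c S S x) \<Longrightarrow> twins c' (S \<union> twins c S S x) S y \<subseteq> twins c S S y"
      "\<And>y. coldeg c' green y S = coldeg c green y S"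
      using settle_twins[OF XeqS x terminal] by metis
    let ?q = "\<lparr>settled = S \<union> twins c S S x, exposed = S, colour = c', target = f'\<rparr>"
    have "green_bounded c' (S \<union> twins c S S x) S" unfolding green_bounded_def
    proof (intro ballI impI)
      fix y assume y: "y \<in> V - (S \<union> twins c S S x)" "nbrs y \<inter> S \<noteq> {}"
      have "card (twins c' (S \<union> twins c S S x) S y) \<le> card (twins c S S y)"
        by (rule card_mono[OF finite_twins[OF y(2)] n(4)[OF y(1)]])
      then have "card (twins c' (S \<union> twins c S S x) S y) * 2 ^ coldeg c' green y S \<le> card (twins c S S y) * 2 ^ coldeg c green y S"
        unfolding n(5) by simp
      also have "\<dots> \<le> \<Delta> - 1" using green_bounded y XeqS by (auto simp: green_bounded_def)
      finally show "card (twins c' (S \<union> twins c S S x) S y) * 2 ^ coldeg c' green y S \<le> \<Delta> - 1" .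
    qed
    then have "admissible ?q" using n by (simp add: admissible_def)
    moreover have "extends p ?q" using n(2,3) XeqS by (auto simp: extends_def defs)
    ultimately have "?q = p" by (rule max)
    then have "settled ?q = S" unfolding defs by simp
    then show False using x self_in_twins[OF x(1), of c S] by auto
  qed
  have "distinguishing_edge_colouring V E c" unfolding distinguishing_edge_colouring_def
  proof (intro ballI impI)
    fix \<phi> assume \<phi>: "\<phi> \<in> automorphisms V E" "preserves_edge_colouring E c \<phi>"
    have perm: "\<phi> permutes V" using aut_perm[OF \<phi>(1)] .
    have "\<phi> r = r"
    proof (rule ccontr)
      assume "\<phi> r \<noteq> r"
      moreover have \<phi>r: "\<phi> r \<in> V" using permutes_in_image[OF perm] root_in by simp
      ultimately have "(\<exists>u\<in>nbrs (\<phi> r). c {\<phi> r, u} = blue) \<or> coldeg c green (\<phi> r) V < root_greens"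
        using unlike_root[of "\<phi> r"] XeqS SeqV by auto
      moreover have "coldeg c blue (\<phi> r) V = 0" "coldeg c green (\<phi> r) V = root_greens"
        using aut_coldeg[OF \<phi> root_in] root_colours by auto
      ultimately show False using coldeg_pos[of c 1 "\<phi> r" V] nbrs_subset[of "\<phi> r"] by auto
    qed
    then have "\<phi> s = s" if "s \<in> V" for s
      using rigid[of c \<phi> s] \<phi> that target_met XeqS SeqV by auto
    then show "\<phi> = id" using permutes_not_in[OF perm] by (intro ext) (metis id_apply)
  qed
  moreover have "c \<in> E \<rightarrow> {..<3}" using three_colours by auto
  ultimately show ?thesis by blast
qed

end

text \<open>A connected graph of degree \<open>0\<close> is a single vertex; in all other cases any vertex can serve as the root.\<close>
theorem theorem3:
  fixes V :: "'a set" and E :: "'a set set" and \<Delta> :: nat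
  assumes "\<Delta> \<noteq> 1"
    and "simple_graph V E"
    and "connected_graph V E"
    and "regular_graph V E \<Delta>"
  shows "distinguishing_index V E \<le> 3"
proof -
  have "\<exists>c \<in> E \<rightarrow> {..<3::nat}. distinguishing_edge_colouring V E c"
  proof (cases "\<Delta> = 0")
    case True
    have "E = {}"
    proof (rule ccontr)
      assume "E \<noteq> {}"
      then obtain e where e: "e \<in> E" by blast
      then obtain v where v: "v \<in> e" "v \<in> V"
      proof -
        have "card e = 2" "e \<subseteq> V" using assms(2) e by (auto simp: simple_graph_def)
        then have "e \<noteq> {}" by auto
        then show ?thesis using that \<open>e \<subseteq> V\<close> by blast
      qed
      then have "incident_edges E v = {}" using assms(4) True by (auto simp: regular_graph_def)
      then show False using e v unfolding incident_edges_def by blast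
    qed
    obtain v where v: "v \<in> V" using assms(3) by (auto simp: connected_graph_def)
    have "u = v" if "u \<in> V" for u
    proof -
      have "(v, u) \<in> {}\<^sup>*" using assms(3) v that \<open>E = {}\<close> by (simp add: connected_graph_def)
      then show ?thesis by simp
    qed
    then have "V = {v}" using v by blast
    then have "\<phi> = id" if "\<phi> \<in> automorphisms V E" for \<phi>
      using that by (simp add: automorphisms_def)
    then have "distinguishing_edge_colouring V E (\<lambda>e. 0::nat)"
      by (simp add: distinguishing_edge_colouring_def)
    then show ?thesis by (intro bexI[of _ "\<lambda>e. 0"]) auto
  next
    case False
    obtain r where "r \<in> V" using assms(3) by (auto simp: connected_graph_def)
    then interpret rooted_regular V E \<Delta> r
      using assms False by unfold_locales auto
    show ?thesis by (rule distinguishing_three_colouring)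
  qed
  then have "enat 3 \<in> {enat k | k. \<exists>c \<in> E \<rightarrow> {..<k}. distinguishing_edge_colouring V E c}"
    by auto
  then have "distinguishing_index V E \<le> enat 3"
    unfolding distinguishing_index_def by (rule Inf_lower)
  then show ?thesis by (simp add: numeral_eq_enat)
qed

end
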